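(* Let $\Bbbk$ be a field of characteristic zero and let the additive group $\mathbb{G}_a$ of $\Bbbk$ act on $V=\Bbbk^5$, and on $\Bbbk[V]=\Bbbk[x,s,t,u,v]$, via the locally nilpotent derivation $$D=x^{3}\frac{\partial}{\partial s}+s\frac{\partial}{\partial t}+t\frac{\partial}{\partial u}+x^{2}\frac{\partial}{\partial v}.$$ The following six polynomials are homogeneous (for the grading with $\deg x=1$, $\deg s=\deg t=\deg u=3$, $\deg v=2$), are invariants, and form a separating set $E=\{f_1,\dots,f_6\}$ in $\Bbbk[V]^{\mathbb{G}_a}$: $$f_{1}=x,\quad f_{2}=2x^{3}t-s^{2},\quad f_{3}=3x^{6}u-3x^{3}ts+s^{3},\quad f_{4}=xv-s,$$ $$f_{5}=x^{2}ts-s^{2}v+2x^{3}tv-3x^{5}u,$$ $$f_{6}=-18x^{3}tsu+9x^{6}u^{2}+8x^{3}t^{3}+6s^{3}u-3t^{2}s^{2}.$$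
   Context: $V=\Bbbk^5$ is the 5-dimensional vector space with coordinate ring the polynomial ring $\Bbbk[V]=\Bbbk[x,s,t,u,v]$, where $x,s,t,u,v$ are the coordinate functions in this order. The $\Bbbk$-derivation $D$ of $\Bbbk[V]$ is locally nilpotent and induces the action of $\mathbb{G}_a$ given by $(-a)\cdot f:=\mu_a(f)=\sum_{k\ge 0}\frac{D^k(f)}{k!}a^k$ for $a\in\mathbb{G}_a$, $f\in\Bbbk[V]$. Explicitly, $(-a)\cdot x=x$, $(-a)\cdot s=s+ax^3$, $(-a)\cdot t=t+as+\frac{a^2}{2}x^3$, $(-a)\cdot u=u+at+\frac{a^2}{2}s+\frac{a^3}{6}x^3$, $(-a)\cdot v=v+ax^2$. The invariant ring is $\Bbbk[V]^{\mathbb{G}_a}=\{f\in\Bbbk[V] : a\cdot f=f \text{ for all } a\in\mathbb{G}_a\}$, and it coincides with $\ker D$. A subset $E\subseteq\Bbbk[V]^{\mathbb{G}_a}$ is a separating set if for any two points $p,q\in V$: whenever $f(p)=f(q)$ for all $f\in E$, then $f(p)=f(q)$ for all $f\in\Bbbk[V]^{\mathbb{G}_a}$. *)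

theory Defs
  imports "HOL-Library.Poly_Mapping" "HOL-Analysis.Finite_Cartesian_Product"
begin

(* Polynomials in variables indexed by 'n are finitely supported coefficient functions on
   the exponent vectors 'n =>0 nat; multiplication on poly_mapping is convolution. *)
type_synonym ('n, 'k) mpoly = "('n \<Rightarrow>\<^sub>0 nat) \<Rightarrow>\<^sub>0 'k"

definition mvar :: "'n \<Rightarrow> ('n, 'k::comm_ring_1) mpoly" where
  "mvar i = Poly_Mapping.single (Poly_Mapping.single i 1) 1"

definition mconst :: "'k \<Rightarrow> ('n, 'k::comm_ring_1) mpoly" where
  "mconst c = Poly_Mapping.single 0 c"

definition meval :: "('n::finite, 'k::comm_ring_1) mpoly \<Rightarrow> 'k ^ 'n \<Rightarrow> 'k" where
  "meval f p = (\<Sum>m\<in>Poly_Mapping.keys f. Poly_Mapping.lookup f m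
                  * (\<Prod>i\<in>UNIV. (p $ i) ^ Poly_Mapping.lookup m i))"

(* The subtraction of exponent vectors truncates only when the exponent of the variable i
   is zero, and then the coefficient vanishes. *)
definition partial :: "'n \<Rightarrow> ('n, 'k::comm_ring_1) mpoly \<Rightarrow> ('n, 'k) mpoly" where
  "partial i f = (\<Sum>m\<in>Poly_Mapping.keys f.
     Poly_Mapping.single (m - Poly_Mapping.single i 1)
       (of_nat (Poly_Mapping.lookup m i) * Poly_Mapping.lookup f m))"

definition homogeneous :: "('n::finite \<Rightarrow> nat) \<Rightarrow> ('n, 'k::comm_ring_1) mpoly \<Rightarrow> bool" where
  "homogeneous w f \<longleftrightarrow>
     (\<exists>d. \<forall>m\<in>Poly_Mapping.keys f. (\<Sum>i\<in>UNIV. w i * Poly_Mapping.lookup m i) = d)"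

(* Sum_any ranges over the k with a nonzero summand.  It is 0 by convention if there are
   infinitely many of them, which does not happen for locally nilpotent D. *)
definition exp_deriv ::
  "(('n, 'k) mpoly \<Rightarrow> ('n, 'k) mpoly) \<Rightarrow> 'k \<Rightarrow> ('n, 'k::field_char_0) mpoly \<Rightarrow> ('n, 'k) mpoly"
  where
  "exp_deriv D a f = (\<Sum>k. mconst (a ^ k / fact k) * (D ^^ k) f)"

(* The sign reflects the convention (-a).f = exp(aD)(f). *)
definition Ga_action ::
  "(('n, 'k) mpoly \<Rightarrow> ('n, 'k) mpoly) \<Rightarrow> 'k \<Rightarrow> ('n, 'k::field_char_0) mpoly \<Rightarrow> ('n, 'k) mpoly"
  where
  "Ga_action D a f = exp_deriv D (- a) f"

definition Ga_invariants ::
  "(('n, 'k) mpoly \<Rightarrow> ('n, 'k) mpoly) \<Rightarrow> ('n, 'k::field_char_0) mpoly set" where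
  "Ga_invariants D = {f. \<forall>a. Ga_action D a f = f}"

definition separating_set ::
  "('n::finite, 'k::comm_ring_1) mpoly set \<Rightarrow> ('n, 'k) mpoly set \<Rightarrow> bool" where
  "separating_set R E \<longleftrightarrow> E \<subseteq> R \<and>
     (\<forall>p q. (\<forall>f\<in>E. meval f p = meval f q) \<longrightarrow> (\<forall>f\<in>R. meval f p = meval f q))"

(* The coordinates x, s, t, u, v carry the indices 1, 2, 3, 4, 5 (and 5 = 0 in the type 5). *)
definition DF_deriv :: "(5, 'k::field_char_0) mpoly \<Rightarrow> (5, 'k) mpoly" where
  "DF_deriv f = mvar 1 ^ 3 * partial 2 f + mvar 2 * partial 3 f
              + mvar 3 * partial 4 f + mvar 1 ^ 2 * partial 5 f"

definition DF_grading :: "5 \<Rightarrow> nat" where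
  "DF_grading = (\<lambda>_. 3)(1 := 1, 5 := 2)"


section \<open>Local nilpotency and the explicit action on the coordinates\<close>

lemma exhaust_5: "i = 1 \<or> i = 2 \<or> i = 3 \<or> i = 4 \<or> i = 5" for i :: 5
proof (induct i)
  case (of_int z)
  then have "0 \<le> z" "z < 5" by simp_all
  then have "z = 0 \<or> z = 1 \<or> z = 2 \<or> z = 3 \<or> z = 4" by arith
  then show ?case by auto
qed

lemma UNIV_5: "(UNIV :: 5 set) = {1, 2, 3, 4, 5}"
  using exhaust_5 by auto

lemma keys_partial:
  "Poly_Mapping.keys (partial i f) \<subseteq>
     {m - Poly_Mapping.single i 1 |m. m \<in> Poly_Mapping.keys f \<and> Poly_Mapping.lookup m i > 0}"
proof -
  have "Poly_Mapping.keys (partial i f) \<subseteq> (\<Union>m\<in>Poly_Mapping.keys f.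
      Poly_Mapping.keys (Poly_Mapping.single (m - Poly_Mapping.single i 1)
       (of_nat (Poly_Mapping.lookup m i) * Poly_Mapping.lookup f m)))"
    unfolding partial_def by (rule Poly_Mapping.keys_sum)
  also have "\<dots> \<subseteq>
     {m - Poly_Mapping.single i 1 |m. m \<in> Poly_Mapping.keys f \<and> Poly_Mapping.lookup m i > 0}"
    by (auto split: if_splits intro!: gr0I)
  finally show ?thesis .
qed

lemma partial_mvar: "partial i (mvar j) = (if i = j then 1 else 0)"
  by (simp add: partial_def mvar_def lookup_single when_def)

lemma partial_0 [simp]: "partial i 0 = 0"
  by (simp add: partial_def)

lemma DF_deriv_0 [simp]: "DF_deriv 0 = 0"
  by (simp add: DF_deriv_def)

(* The degree in which the variables x, s, t, u, v count 0, 1, 2, 3, 1. *)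
definition nil_degree :: "(5 \<Rightarrow>\<^sub>0 nat) \<Rightarrow> nat" where
  "nil_degree m = Poly_Mapping.lookup m 2 + 2 * Poly_Mapping.lookup m 3
                + 3 * Poly_Mapping.lookup m 4 + Poly_Mapping.lookup m 5"

lemma mvar_power: "mvar i ^ k = Poly_Mapping.single (Poly_Mapping.single i k) 1"
  by (induct k) (simp_all add: mvar_def mult_single single_add [symmetric])

lemma DF_deriv_nil_degree:
  assumes m: "m \<in> Poly_Mapping.keys (DF_deriv f)"
  obtains n where "n \<in> Poly_Mapping.keys f" "nil_degree n = Suc (nil_degree m)"
proof -
  have key: "\<exists>n\<in>Poly_Mapping.keys f. Poly_Mapping.lookup n i > 0 \<and>
          m = Poly_Mapping.single j k + (n - Poly_Mapping.single i 1)"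
    if "m \<in> Poly_Mapping.keys (mvar j ^ k * partial i f)" for i j k
  proof -
    from that obtain a b where "a \<in> Poly_Mapping.keys (mvar j ^ k :: (5, 'a) mpoly)"
      "b \<in> Poly_Mapping.keys (partial i f)" "m = a + b"
      using keys_mult [of "mvar j ^ k" "partial i f"] by blast
    then show ?thesis
      using keys_partial [of i f] by (auto simp: mvar_power)
  qed
  have "m \<in> Poly_Mapping.keys (mvar 1 ^ 3 * partial 2 f) \<or> m \<in> Poly_Mapping.keys (mvar 2 ^ 1 * partial 3 f)
      \<or> m \<in> Poly_Mapping.keys (mvar 3 ^ 1 * partial 4 f) \<or> m \<in> Poly_Mapping.keys (mvar 1 ^ 2 * partial 5 f)"
    using m unfolding DF_deriv_def by (auto dest!: subsetD [OF Poly_Mapping.keys_add])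
  then have "\<exists>n\<in>Poly_Mapping.keys f. nil_degree n = Suc (nil_degree m)"
  proof (elim disjE)
    assume "m \<in> Poly_Mapping.keys (mvar 1 ^ 3 * partial 2 f)"
    from key [OF this] show ?thesis
      by (auto simp: nil_degree_def lookup_add lookup_minus lookup_single when_def intro!: bexI)
  next
    assume "m \<in> Poly_Mapping.keys (mvar 2 ^ 1 * partial 3 f)"
    from key [OF this] show ?thesis
      by (auto simp: nil_degree_def lookup_add lookup_minus lookup_single when_def intro!: bexI)
  next
    assume "m \<in> Poly_Mapping.keys (mvar 3 ^ 1 * partial 4 f)"
    from key [OF this] show ?thesis
      by (auto simp: nil_degree_def lookup_add lookup_minus lookup_single when_def intro!: bexI)
  next
    assume "m \<in> Poly_Mapping.keys (mvar 1 ^ 2 * partial 5 f)"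
    from key [OF this] show ?thesis
      by (auto simp: nil_degree_def lookup_add lookup_minus lookup_single when_def intro!: bexI)
  qed
  then show ?thesis using that by blast
qed

lemma DF_deriv_funpow_0: "(DF_deriv ^^ n) 0 = 0"
  by (induct n) simp_all

theorem DF_deriv_locally_nilpotent: "\<exists>n. (DF_deriv ^^ n) f = 0"
proof -
  have *: "(DF_deriv ^^ n) g = 0" if "\<forall>m\<in>Poly_Mapping.keys g. nil_degree m < n"
    for n and g :: "(5, 'a) mpoly"
    using that
  proof (induct n arbitrary: g)
    case 0
    then have "Poly_Mapping.keys g = {}" by auto
    then show ?case by simp
  next
    case (Suc n)
    have "\<forall>m\<in>Poly_Mapping.keys (DF_deriv g). nil_degree m < n"
    proof
      fix m assume "m \<in> Poly_Mapping.keys (DF_deriv g)"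
      then obtain l where "l \<in> Poly_Mapping.keys g" "nil_degree l = Suc (nil_degree m)"
        by (rule DF_deriv_nil_degree)
      with Suc.prems show "nil_degree m < n" by force
    qed
    then have "(DF_deriv ^^ n) (DF_deriv g) = 0" by (rule Suc.hyps)
    then show ?case by (simp add: funpow_swap1)
  qed
  have "\<forall>m\<in>Poly_Mapping.keys f. nil_degree m < Suc (\<Sum>m\<in>Poly_Mapping.keys f. nil_degree m)"
    by (auto simp: less_Suc_eq_le intro: member_le_sum)
  then show ?thesis using * by blast
qed

lemma exp_deriv_eq_sum:
  assumes "(DF_deriv ^^ n) f = 0"
  shows "exp_deriv DF_deriv a f = (\<Sum>k<n. mconst (a ^ k / fact k) * (DF_deriv ^^ k) f)"
  unfolding exp_deriv_def
proof (rule Sum_any.expand_superset)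
  show "{k. mconst (a ^ k / fact k) * (DF_deriv ^^ k) f \<noteq> 0} \<subseteq> {..<n}"
  proof
    fix k assume "k \<in> {k. mconst (a ^ k / fact k) * (DF_deriv ^^ k) f \<noteq> 0}"
    then have "(DF_deriv ^^ k) f \<noteq> 0" by auto
    moreover have "(DF_deriv ^^ k) f = 0" if "n \<le> k"
    proof -
      have "(DF_deriv ^^ ((k - n) + n)) f = (DF_deriv ^^ (k - n)) ((DF_deriv ^^ n) f)"
        by (simp only: funpow_add o_apply)
      then show ?thesis using that assms by (simp add: DF_deriv_funpow_0)
    qed
    ultimately show "k \<in> {..<n}" by (meson lessThan_iff not_le)
  qed
qed simp

lemma partial_mvar_1_power [simp]: "i \<noteq> 1 \<Longrightarrow> partial i (mvar 1 ^ k :: (5, 'k::comm_ring_1) mpoly) = 0"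
  by (simp add: partial_def mvar_power lookup_single when_def)

lemma DF_deriv_coordinates:
  "DF_deriv (mvar 1) = 0" "DF_deriv (mvar 2) = mvar 1 ^ 3" "DF_deriv (mvar 3) = mvar 2"
  "DF_deriv (mvar 4) = mvar 3" "DF_deriv (mvar 5) = mvar 1 ^ 2" "DF_deriv (mvar 1 ^ k) = 0"
  by (simp_all add: DF_deriv_def partial_mvar)

theorem Ga_action_coordinates:
  "Ga_action DF_deriv (- a) (mvar 1) = mvar 1"
  "Ga_action DF_deriv (- a) (mvar 2) = mvar 2 + mconst a * mvar 1 ^ 3"
  "Ga_action DF_deriv (- a) (mvar 3)
     = mvar 3 + mconst a * mvar 2 + mconst (a\<^sup>2 / 2) * mvar 1 ^ 3"
  "Ga_action DF_deriv (- a) (mvar 4)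
     = mvar 4 + mconst a * mvar 3 + mconst (a\<^sup>2 / 2) * mvar 2 + mconst (a ^ 3 / 6) * mvar 1 ^ 3"
  "Ga_action DF_deriv (- a) (mvar 5) = mvar 5 + mconst a * mvar 1 ^ 2"
proof -
  have one: "mconst 1 = (1 :: (5, 'a) mpoly)" by (simp add: mconst_def)
  have sum4: "(\<Sum>k<4. g k) = g 0 + g 1 + g 2 + g 3" for g :: "nat \<Rightarrow> (5, 'a) mpoly"
    by (simp add: eval_nat_numeral)
  have fct: "fact 2 = (2 :: 'a)" "fact 3 = (6 :: 'a)" by (simp_all add: fact_numeral)
  have pow: "(DF_deriv ^^ 0) f = f" "(DF_deriv ^^ Suc 0) f = DF_deriv f"
    "(DF_deriv ^^ 2) f = DF_deriv (DF_deriv f)"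
    "(DF_deriv ^^ 3) f = DF_deriv (DF_deriv (DF_deriv f))"
    "(DF_deriv ^^ 4) f = DF_deriv (DF_deriv (DF_deriv (DF_deriv f)))"
    for f :: "(5, 'a) mpoly"
    by (simp_all add: eval_nat_numeral)
  have eq: "Ga_action DF_deriv (- a) f = f + mconst a * DF_deriv f
      + mconst (a\<^sup>2 / 2) * DF_deriv (DF_deriv f)
      + mconst (a ^ 3 / 6) * DF_deriv (DF_deriv (DF_deriv f))"
    if "DF_deriv (DF_deriv (DF_deriv (DF_deriv f))) = 0" for f
    using exp_deriv_eq_sum [of 4 f a] that
    by (simp add: Ga_action_def sum4 pow fct one del: funpow.simps)
  show
  "Ga_action DF_deriv (- a) (mvar 1) = mvar 1"
  "Ga_action DF_deriv (- a) (mvar 2) = mvar 2 + mconst a * mvar 1 ^ 3"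
  "Ga_action DF_deriv (- a) (mvar 3)
     = mvar 3 + mconst a * mvar 2 + mconst (a\<^sup>2 / 2) * mvar 1 ^ 3"
  "Ga_action DF_deriv (- a) (mvar 4)
     = mvar 4 + mconst a * mvar 3 + mconst (a\<^sup>2 / 2) * mvar 2 + mconst (a ^ 3 / 6) * mvar 1 ^ 3"
  "Ga_action DF_deriv (- a) (mvar 5) = mvar 5 + mconst a * mvar 1 ^ 2"
    by (simp_all add: eq DF_deriv_coordinates)
qed

end

theory Submission
  imports Defs "HOL-Computational_Algebra.Polynomial"
begin

text \<open>
  An invariant \<open>f\<close> is a polynomial with \<open>D f = 0\<close>, hence constant along orbits. If \<open>x \<noteq> 0\<close>, the
  action moves a point to \<open>s = 0\<close>, and the coordinates of the new point are fractions in
  \<open>f\<^sub>1, \<dots>, f\<^sub>4\<close>. If \<open>x = 0\<close> and \<open>s \<noteq> 0\<close>, it moves the point to \<open>t = 0\<close>, and the new coordinates are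
  determined by \<open>f\<^sub>4, f\<^sub>5, f\<^sub>6\<close>. If \<open>x = s = 0\<close>, all invariants are constant: degenerating pairs
  of points on one orbit gives \<open>f (0, 0, t, u, v) = f (0, 0, - 2 * t, u, v)\<close>, so \<open>f\<close> does not depend on
  \<open>t\<close>; the action for \<open>t = 1\<close> then shows that it does not depend on \<open>u\<close>; finally \<open>D f = 0\<close> at
  \<open>(x, 0, 0, 0, v)\<close> reads \<open>x\<^sup>2 * (x * f\<^sub>s + f\<^sub>v) = 0\<close>, so that \<open>f\<^sub>v\<close> vanishes at \<open>(0, 0, 0, 0, v)\<close>.
\<close>

section \<open>Induction and sums over supports of finitely supported functions\<close>

lemma poly_mapping_single_induct [case_names zero single_add]:
  fixes f :: "'a \<Rightarrow>\<^sub>0 'b::comm_monoid_add"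
  assumes "P 0" and "\<And>m c g. P g \<Longrightarrow> P (Poly_Mapping.single m c + g)"
  shows "P f"
proof (induction f rule: update_induct)
  case const
  show ?case by (fact assms(1))
next
  case (update f a b)
  have "Poly_Mapping.update a b f = Poly_Mapping.single a b + f"
    using update(1)
    by (intro poly_mapping_eqI)
       (auto simp: lookup_update lookup_add lookup_single when_def in_keys_iff)
  with assms(2) update(3) show ?case by simp
qed

lemma sum_keys_superset:
  fixes h :: "'a \<Rightarrow> 'b::zero \<Rightarrow> 'c::comm_monoid_add"
  assumes "finite A" "Poly_Mapping.keys f \<subseteq> A" "\<And>m. h m 0 = 0"
  shows "(\<Sum>m\<in>Poly_Mapping.keys f. h m (Poly_Mapping.lookup f m))
       = (\<Sum>m\<in>A. h m (Poly_Mapping.lookup f m))"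
  using assms by (intro sum.mono_neutral_left) (auto simp: in_keys_iff)

text \<open>Both supports are enlarged to their union, where the added terms are
  \<open>h m 0 = 0\<close>. This yields the additivity of \<open>partial\<close> and of
  \<open>peval\<close> at once.\<close>

lemma sum_keys_add:
  fixes h :: "'a \<Rightarrow> 'b::monoid_add \<Rightarrow> 'c::comm_monoid_add"
  assumes "\<And>m. h m 0 = 0" "\<And>m c d. h m (c + d) = h m c + h m d"
  shows "(\<Sum>m\<in>Poly_Mapping.keys (f + g). h m (Poly_Mapping.lookup (f + g) m))
       = (\<Sum>m\<in>Poly_Mapping.keys f. h m (Poly_Mapping.lookup f m))
       + (\<Sum>m\<in>Poly_Mapping.keys g. h m (Poly_Mapping.lookup g m))"
proof -
  let ?A = "Poly_Mapping.keys f \<union> Poly_Mapping.keys g"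
  have "Poly_Mapping.keys (f + g) \<subseteq> ?A"
    by (rule Poly_Mapping.keys_add)
  then show ?thesis
    by (simp add: sum_keys_superset [where A = ?A and h = h] sum.distrib assms(1))
       (simp add: lookup_add assms(2) sum.distrib)
qed


section \<open>Partial derivatives\<close>

lemma partial_single:
  "partial i (Poly_Mapping.single m c)
     = Poly_Mapping.single (m - Poly_Mapping.single i 1) (of_nat (Poly_Mapping.lookup m i) * c)"
  by (simp add: partial_def)

lemma partial_add: "partial i (f + g) = partial i f + partial i g"
  unfolding partial_def
  by (rule sum_keys_add [where h = "\<lambda>m c. Poly_Mapping.single (m - Poly_Mapping.single i 1)
       (of_nat (Poly_Mapping.lookup m i) * c)"]) (simp_all add: single_add distrib_left)

lemma partial_mult_single:
  "partial i (Poly_Mapping.single m c * Poly_Mapping.single n d)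
     = Poly_Mapping.single m c * partial i (Poly_Mapping.single n d)
     + partial i (Poly_Mapping.single m c) * Poly_Mapping.single n d"
proof -
  let ?e = "Poly_Mapping.single i (1::nat)"
  \<comment> \<open>Subtraction of exponents truncates, so these identities need a positive exponent
    of the variable \<open>i\<close>. If it is zero, the factor \<open>of_nat\<close> kills the
    term.\<close>
  have 1: "m + (n - ?e) = m + n - ?e" if "Poly_Mapping.lookup n i > 0"
    using that by (intro poly_mapping_eqI) (auto simp: lookup_add lookup_minus lookup_single when_def)
  have 2: "m - ?e + n = m + n - ?e" if "Poly_Mapping.lookup m i > 0"
    using that by (intro poly_mapping_eqI) (auto simp: lookup_add lookup_minus lookup_single when_def)
  have "Poly_Mapping.single m c * partial i (Poly_Mapping.single n d)
      = Poly_Mapping.single (m + n - ?e) (of_nat (Poly_Mapping.lookup n i) * (c * d))"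
    using 1 by (cases "Poly_Mapping.lookup n i = 0") (auto simp: partial_single mult_single mult_ac)
  moreover have "partial i (Poly_Mapping.single m c) * Poly_Mapping.single n d
      = Poly_Mapping.single (m + n - ?e) (of_nat (Poly_Mapping.lookup m i) * (c * d))"
    using 2 by (cases "Poly_Mapping.lookup m i = 0") (auto simp: partial_single mult_single mult_ac add.commute)
  ultimately show ?thesis
    by (simp add: partial_single mult_single lookup_add single_add [symmetric] algebra_simps)
qed

lemma partial_mult: "partial i (f * g) = f * partial i g + partial i f * g"
proof (induction f rule: poly_mapping_single_induct)
  case (single_add m c f)
  have "partial i (Poly_Mapping.single m c * g)
      = Poly_Mapping.single m c * partial i g + partial i (Poly_Mapping.single m c) * g"
  proof (induction g rule: poly_mapping_single_induct)
    case (single_add n d g)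
    then show ?case by (simp add: partial_add distrib_left partial_mult_single)
  qed simp
  with single_add show ?case
    by (simp add: partial_add distrib_right)
qed simp

lemma DF_deriv_add: "DF_deriv (f + g) = DF_deriv f + DF_deriv g"
  by (simp add: DF_deriv_def partial_add algebra_simps)

lemma DF_deriv_mult: "DF_deriv (f * g) = f * DF_deriv g + DF_deriv f * g"
  by (simp add: DF_deriv_def partial_mult algebra_simps)

lemma DF_deriv_minus: "DF_deriv (- f) = - DF_deriv f"
  using DF_deriv_add [of f "- f"] by (simp add: eq_neg_iff_add_eq_0 add.commute)

lemma DF_deriv_diff: "DF_deriv (f - g) = DF_deriv f - DF_deriv g"
  using DF_deriv_add [of f "- g"] by (simp add: DF_deriv_minus)

lemma DF_deriv_1 [simp]: "DF_deriv 1 = 0"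
  using DF_deriv_mult [of 1 1] by simp

lemma DF_deriv_numeral [simp]: "DF_deriv (numeral n) = 0"
  by (induction n) (simp_all only: numeral.simps DF_deriv_add DF_deriv_1 add_0)

lemma DF_deriv_power_Suc: "DF_deriv (f ^ Suc n) = of_nat (Suc n) * f ^ n * DF_deriv f"
  by (induction n) (simp_all add: DF_deriv_mult algebra_simps)

lemma DF_deriv_power_numeral:
  "DF_deriv (f ^ numeral n) = numeral n * f ^ pred_numeral n * DF_deriv f"
  using DF_deriv_power_Suc [of f "pred_numeral n"]
  by (simp only: numeral_eq_Suc [symmetric] of_nat_numeral)


section \<open>Evaluation along polynomial curves\<close>

text \<open>The curve parameter stays an indeterminate, so over any field of characteristic zero one
  can differentiate along a curve, or cancel the parameter before setting it to 0, without
  limits.\<close>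

definition peval :: "('n::finite, 'k::comm_ring_1) mpoly \<Rightarrow> 'k poly ^ 'n \<Rightarrow> 'k poly" where
  "peval f \<gamma> = (\<Sum>m\<in>Poly_Mapping.keys f. smult (Poly_Mapping.lookup f m)
                  (\<Prod>i\<in>UNIV. (\<gamma> $ i) ^ Poly_Mapping.lookup m i))"

lemma poly_peval: "poly (peval f \<gamma>) a = meval f (\<chi> i. poly (\<gamma> $ i) a)"
  by (simp add: peval_def meval_def poly_sum poly_prod)

lemma peval_0 [simp]: "peval 0 \<gamma> = 0"
  by (simp add: peval_def)

lemma peval_single:
  "peval (Poly_Mapping.single m c) \<gamma> = smult c (\<Prod>i\<in>UNIV. (\<gamma> $ i) ^ Poly_Mapping.lookup m i)"
  by (simp add: peval_def)

lemma peval_add: "peval (f + g) \<gamma> = peval f \<gamma> + peval g \<gamma>"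
  unfolding peval_def
  by (rule sum_keys_add [where h = "\<lambda>m c. smult c (\<Prod>i\<in>UNIV. (\<gamma> $ i) ^ Poly_Mapping.lookup m i)"])
     (simp_all add: smult_add_left)

lemma peval_mult: "peval (f * g) \<gamma> = peval f \<gamma> * peval g \<gamma>"
proof (induction f rule: poly_mapping_single_induct)
  case (single_add m c f)
  have "peval (Poly_Mapping.single m c * g) \<gamma> = peval (Poly_Mapping.single m c) \<gamma> * peval g \<gamma>"
  proof (induction g rule: poly_mapping_single_induct)
    case (single_add n d g)
    have "peval (Poly_Mapping.single m c * Poly_Mapping.single n d) \<gamma>
        = peval (Poly_Mapping.single m c) \<gamma> * peval (Poly_Mapping.single n d) \<gamma>"
      by (simp add: mult_single peval_single lookup_add power_add prod.distrib mult.commute)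
    with single_add show ?case by (simp add: distrib_left peval_add)
  qed simp
  with single_add show ?case by (simp add: distrib_right peval_add)
qed simp

lemma peval_mvar: "peval (mvar i) \<gamma> = \<gamma> $ i"
proof -
  have "(\<Prod>j\<in>UNIV. (\<gamma> $ j) ^ Poly_Mapping.lookup (Poly_Mapping.single i 1) j)
      = (\<Prod>j\<in>UNIV. if i = j then \<gamma> $ j else 1)"
    by (intro prod.cong) (auto simp: lookup_single)
  then show ?thesis by (simp add: mvar_def peval_single)
qed

lemma peval_1 [simp]: "peval 1 \<gamma> = 1"
  using peval_single [of 0 1 \<gamma>] by (simp add: single_one)

lemma peval_power: "peval (f ^ n) \<gamma> = peval f \<gamma> ^ n"
  by (induction n) (simp_all add: peval_mult)

lemma smult_sum_right: "smult c (\<Sum>i\<in>A. p i) = (\<Sum>i\<in>A. smult c (p i))"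
  by (induction A rule: infinite_finite_induct) (simp_all add: smult_add_right)

text \<open>The chain rule. By additivity it reduces to a single monomial, where it is the product
  rule.\<close>

lemma pderiv_peval:
  fixes f :: "('n::finite, 'k::idom) mpoly"
  shows "pderiv (peval f \<gamma>) = (\<Sum>i\<in>UNIV. peval (partial i f) \<gamma> * pderiv (\<gamma> $ i))"
proof (induction f rule: poly_mapping_single_induct)
  case (single_add m c f)
  have "smult c ((\<Prod>j\<in>UNIV - {i}. (\<gamma> $ j) ^ Poly_Mapping.lookup m j)
          * pderiv ((\<gamma> $ i) ^ Poly_Mapping.lookup m i))
      = peval (partial i (Poly_Mapping.single m c)) \<gamma> * pderiv (\<gamma> $ i)" for i
  proof -
    have "(\<Prod>j\<in>UNIV - {i}. (\<gamma> $ j) ^ Poly_Mapping.lookup (m - Poly_Mapping.single i 1) j)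
        = (\<Prod>j\<in>UNIV - {i}. (\<gamma> $ j) ^ Poly_Mapping.lookup m j)"
      by (intro prod.cong) (auto simp: lookup_minus lookup_single)
    then have "(\<Prod>j\<in>UNIV. (\<gamma> $ j) ^ Poly_Mapping.lookup (m - Poly_Mapping.single i 1) j)
        = (\<gamma> $ i) ^ (Poly_Mapping.lookup m i - 1)
          * (\<Prod>j\<in>UNIV - {i}. (\<gamma> $ j) ^ Poly_Mapping.lookup m j)"
      by (simp add: prod.remove [of UNIV i] lookup_minus)
    then show ?thesis
      by (simp add: partial_single peval_single pderiv_power mult_ac)
  qed
  then have "pderiv (peval (Poly_Mapping.single m c) \<gamma>)
      = (\<Sum>i\<in>UNIV. peval (partial i (Poly_Mapping.single m c)) \<gamma> * pderiv (\<gamma> $ i))"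
    by (simp add: peval_single [of m c] pderiv_smult pderiv_prod smult_sum_right)
  with single_add show ?case
    by (simp add: peval_add partial_add pderiv_add distrib_right sum.distrib)
qed simp

text \<open>A point is a constant curve, so \<open>meval\<close> inherits the ring homomorphism laws
  from \<open>peval\<close>.\<close>

lemma meval_eq_poly_peval: "meval f p = poly (peval f (\<chi> i. [:p $ i:])) 0"
  by (simp add: poly_peval)

lemma meval_add: "meval (f + g) p = meval f p + meval g p"
  by (simp add: meval_eq_poly_peval peval_add)

lemma meval_mult: "meval (f * g) p = meval f p * meval g p"
  by (simp add: meval_eq_poly_peval peval_mult)

lemma meval_mvar: "meval (mvar i) p = p $ i"
  by (simp add: meval_eq_poly_peval peval_mvar)

lemma meval_0 [simp]: "meval 0 p = 0"
  by (simp add: meval_eq_poly_peval)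

lemma meval_1 [simp]: "meval 1 p = 1"
  by (simp add: meval_eq_poly_peval)

lemma meval_power: "meval (f ^ n) p = meval f p ^ n"
  by (simp add: meval_eq_poly_peval peval_power)

lemma meval_minus: "meval (- f) p = - meval f p"
  using meval_add [of f "- f" p] by (simp add: eq_neg_iff_add_eq_0 add.commute)

lemma meval_diff: "meval (f - g) p = meval f p - meval g p"
  using meval_add [of f "- g" p] by (simp add: meval_minus)

lemma meval_numeral [simp]: "meval (numeral n) p = numeral n"
  by (induction n) (simp_all only: numeral.simps meval_add meval_1)

lemmas meval_simps = meval_add meval_mult meval_mvar meval_power meval_minus meval_diff


section \<open>Invariants are the kernel of the derivation\<close>

lemma lookup_mconst_mult:
  "Poly_Mapping.lookup (mconst c * f) m = c * Poly_Mapping.lookup f m"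
  by (induction f rule: poly_mapping_single_induct)
     (auto simp: mconst_def mult_single distrib_left lookup_add lookup_single when_def)

text \<open>Each coefficient of \<open>exp (a D) f\<close> is a polynomial in \<open>a\<close> whose
  linear coefficient is that of \<open>D f\<close>. Invariance makes it constant as a function,
  hence as a polynomial, since the field is infinite.\<close>

lemma DF_deriv_eq_0_if_invariant:
  assumes "f \<in> Ga_invariants DF_deriv"
  shows "DF_deriv f = 0"
proof (rule poly_mapping_eqI)
  fix m
  obtain n where "(DF_deriv ^^ n) f = 0"
    using DF_deriv_locally_nilpotent by blast
  \<comment> \<open>The bound is raised by two so that the index 1 surely occurs in the sum.\<close>
  then have n: "(DF_deriv ^^ Suc (Suc n)) f = 0"
    by simp
  define P where "P = (\<Sum>k<Suc (Suc n).
    monom (Poly_Mapping.lookup ((DF_deriv ^^ k) f) m / fact k) k)"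
  have "poly P a = poly [:Poly_Mapping.lookup f m:] a" for a
  proof -
    have "Ga_action DF_deriv (- a) f = f"
      using assms by (simp add: Ga_invariants_def)
    then have "(\<Sum>k<Suc (Suc n). mconst (a ^ k / fact k) * (DF_deriv ^^ k) f) = f"
      using exp_deriv_eq_sum [OF n, of a] by (simp only: Ga_action_def minus_minus)
    from arg_cong [OF this, of "\<lambda>g. Poly_Mapping.lookup g m"] show ?thesis
      by (simp add: P_def poly_sum poly_monom lookup_sum lookup_add lookup_mconst_mult mult.commute [of "a ^ _"]
          del: sum.lessThan_Suc)
  qed
  then have "P = [:Poly_Mapping.lookup f m:]"
    by (simp add: poly_eq_poly_eq_iff [symmetric] fun_eq_iff)
  then have "coeff P 1 = 0" by simp
  moreover have "coeff P 1 = (\<Sum>k<Suc (Suc n). if k = 1 then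
      Poly_Mapping.lookup ((DF_deriv ^^ k) f) m / fact k else 0)"
    unfolding P_def coeff_sum by (intro sum.cong) auto
  ultimately show "Poly_Mapping.lookup (DF_deriv f) m = Poly_Mapping.lookup 0 m"
    by (simp add: sum.delta del: sum.lessThan_Suc)
qed

lemma invariant_if_DF_deriv_eq_0:
  assumes "DF_deriv f = 0"
  shows "f \<in> Ga_invariants DF_deriv"
proof -
  have "mconst 1 = (1 :: (5, 'a) mpoly)" by (simp add: mconst_def)
  then have "exp_deriv DF_deriv a f = f" for a
    using exp_deriv_eq_sum [of 1 f a] assms by simp
  then show ?thesis by (simp add: Ga_invariants_def Ga_action_def)
qed


section \<open>Homogeneity\<close>

text \<open>Exposing the degree, which \<open>homogeneous\<close> hides behind an existential, gives
  closure under addition.\<close>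

definition homogeneous_of :: "('n::finite \<Rightarrow> nat) \<Rightarrow> nat \<Rightarrow> ('n, 'k::comm_ring_1) mpoly \<Rightarrow> bool" where
  "homogeneous_of w d f \<longleftrightarrow>
     (\<forall>m\<in>Poly_Mapping.keys f. (\<Sum>i\<in>UNIV. w i * Poly_Mapping.lookup m i) = d)"

lemma homogeneous_of_imp_homogeneous: "homogeneous_of w d f \<Longrightarrow> homogeneous w f"
  by (auto simp: homogeneous_of_def homogeneous_def)

lemma homogeneous_of_add:
  "homogeneous_of w d f \<Longrightarrow> homogeneous_of w d g \<Longrightarrow> homogeneous_of w d (f + g)"
  unfolding homogeneous_of_def using Poly_Mapping.keys_add [of f g] by blast

lemma homogeneous_of_minus: "homogeneous_of w d f \<Longrightarrow> homogeneous_of w d (- f)"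
  by (simp add: homogeneous_of_def)

lemma homogeneous_of_diff:
  "homogeneous_of w d f \<Longrightarrow> homogeneous_of w d g \<Longrightarrow> homogeneous_of w d (f - g)"
  using homogeneous_of_add [OF _ homogeneous_of_minus, of w d f g] by simp

lemma homogeneous_of_mult:
  assumes "homogeneous_of w d f" "homogeneous_of w e g"
  shows "homogeneous_of w (d + e) (f * g)"
  unfolding homogeneous_of_def
proof
  fix m assume "m \<in> Poly_Mapping.keys (f * g)"
  then obtain a b where "a \<in> Poly_Mapping.keys f" "b \<in> Poly_Mapping.keys g" "m = a + b"
    using keys_mult [of f g] by blast
  with assms show "(\<Sum>i\<in>UNIV. w i * Poly_Mapping.lookup m i) = d + e"
    by (simp add: homogeneous_of_def lookup_add distrib_left sum.distrib)
qed

lemma homogeneous_of_1: "homogeneous_of w 0 1"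
  by (simp add: homogeneous_of_def)

lemma homogeneous_of_numeral: "homogeneous_of w 0 (numeral n)"
  by (induction n) (simp_all only: numeral.simps homogeneous_of_1 homogeneous_of_add)

lemma homogeneous_of_power: "homogeneous_of w d f \<Longrightarrow> homogeneous_of w (n * d) (f ^ n)"
  by (induction n) (simp_all add: homogeneous_of_1 homogeneous_of_mult)

lemma homogeneous_of_mvar: "homogeneous_of w (w i) (mvar i)"
proof -
  have "(\<Sum>j\<in>UNIV. w j * Poly_Mapping.lookup (Poly_Mapping.single i 1) j)
      = (\<Sum>j\<in>UNIV. if i = j then w j else 0)"
    by (intro sum.cong) (auto simp: lookup_single)
  then show ?thesis by (simp add: homogeneous_of_def mvar_def)
qed


section \<open>Values of invariants\<close>

definition point5 :: "'a \<Rightarrow> 'a \<Rightarrow> 'a \<Rightarrow> 'a \<Rightarrow> 'a \<Rightarrow> 'a ^ 5" where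
  "point5 x s t u v =
     (\<chi> i. if i = 1 then x else if i = 2 then s else if i = 3 then t else if i = 4 then u else v)"

lemma point5_nth [simp]:
  "point5 x s t u v $ 1 = x" "point5 x s t u v $ 2 = s" "point5 x s t u v $ 3 = t"
  "point5 x s t u v $ 4 = u" "point5 x s t u v $ 5 = v"
  by (simp_all add: point5_def)

lemma point5_eta: "point5 (p $ 1) (p $ 2) (p $ 3) (p $ 4) (p $ 5) = p"
  unfolding vec_eq_iff
proof
  fix i :: 5
  show "point5 (p $ 1) (p $ 2) (p $ 3) (p $ 4) (p $ 5) $ i = p $ i"
    using exhaust_5 [of i] by (elim disjE) simp_all
qed

lemma poly_point5:
  "(\<chi> i. poly (point5 x s t u v $ i) a)
     = point5 (poly x a) (poly s a) (poly t a) (poly u a) (poly v a)"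
  by (simp add: point5_def vec_eq_iff)

lemma sum_UNIV_5: "(\<Sum>i\<in>UNIV. h i) = h 1 + h 2 + h 3 + h 4 + h (5 :: 5)"
  unfolding UNIV_5 by (simp add: add.assoc)

lemma pderiv_eq_0_imp_poly_eq:
  fixes p :: "'k::field_char_0 poly"
  shows "pderiv p = 0 \<Longrightarrow> poly p a = poly p b"
  using pderiv_iszero [of p] by auto

text \<open>Leading coefficients give \<open>(- 2) ^ d = 1\<close> for the degree \<open>d\<close>.
  In characteristic zero this holds in the integers too, where parity forces
  \<open>d = 0\<close>.\<close>

lemma degree_0_if_pcompose_eq:
  fixes p :: "'k::field_char_0 poly"
  assumes "pcompose p [:0, - 2:] = p"
  shows "degree p = 0"
proof (rule ccontr)
  assume "degree p \<noteq> 0"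
  then have "degree p > 0" and nz: "coeff p (degree p) \<noteq> 0" by auto
  have "(- 2) ^ degree p * coeff p (degree p) = coeff p (degree p)"
    using coeff_pcompose_linear [of p "- 2" "degree p"] assms by simp
  with nz have "(- 2 :: 'k) ^ degree p = 1" by simp
  then have "of_int ((- 2) ^ degree p) = (of_int 1 :: 'k)" by simp
  then have "(- 2 :: int) ^ degree p = 1" by (simp only: of_int_eq_iff)
  moreover have "even ((- 2 :: int) ^ degree p)" using \<open>degree p > 0\<close> by simp
  ultimately show False by simp
qed

section \<open>Values of a kernel element along the flow\<close>

context
  fixes f :: "(5, 'k::field_char_0) mpoly"
  assumes DF0: "DF_deriv f = 0"
begin

text \<open>The orbit is an integral curve of \<open>D\<close>, so by the chain rule the derivative
  of \<open>f\<close> along it is \<open>D f = 0\<close>.\<close>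

lemma meval_flow:
  "meval f (point5 x (s + a * x ^ 3) (t + a * s + a\<^sup>2 / 2 * x ^ 3)
      (u + a * t + a\<^sup>2 / 2 * s + a ^ 3 / 6 * x ^ 3) (v + a * x\<^sup>2))
   = meval f (point5 x s t u v)"
proof -
  let ?g = "point5 [:x:] [:s, x ^ 3:] [:t, s, x ^ 3 / 2:] [:u, t, s / 2, x ^ 3 / 6:] [:v, x\<^sup>2:]"
  have "pderiv (?g $ 1) = 0" "pderiv (?g $ 2) = ?g $ 1 ^ 3" "pderiv (?g $ 3) = ?g $ 2"
    "pderiv (?g $ 4) = ?g $ 3" "pderiv (?g $ 5) = (?g $ 1)\<^sup>2"
    by (simp_all add: pderiv_pCons power2_eq_square power3_eq_cube)
  then have "pderiv (peval f ?g) = peval (DF_deriv f) ?g"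
    unfolding pderiv_peval sum_UNIV_5 DF_deriv_def peval_add peval_mult peval_power peval_mvar
    by (simp only: mult.commute mult_zero_left mult_zero_right add_0_left)
  then have "poly (peval f ?g) a = poly (peval f ?g) 0"
    by (intro pderiv_eq_0_imp_poly_eq) (simp add: DF0)
  moreover have "poly [:s, x ^ 3:] a = s + a * x ^ 3"
    "poly [:t, s, x ^ 3 / 2:] a = t + a * s + a\<^sup>2 / 2 * x ^ 3"
    "poly [:u, t, s / 2, x ^ 3 / 6:] a = u + a * t + a\<^sup>2 / 2 * s + a ^ 3 / 6 * x ^ 3"
    "poly [:v, x\<^sup>2:] a = v + a * x\<^sup>2"
    by (simp_all add: power2_eq_square power3_eq_cube distrib_left mult.assoc)
  ultimately show ?thesis
    by (simp add: poly_peval poly_point5 add.assoc)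
qed

text \<open>The parameter \<open>?a\<close> solves \<open>s + a * x ^ 3 = 0\<close>; the numerators
  that appear are the values of \<open>f2\<close>, \<open>f3\<close> and \<open>f4\<close>.\<close>

lemma meval_normal_form_x:
  assumes "x \<noteq> 0"
  shows "meval f (point5 x s t u v)
       = meval f (point5 x 0 ((2 * x ^ 3 * t - s\<^sup>2) / (2 * x ^ 3))
           ((3 * x ^ 6 * u - 3 * x ^ 3 * t * s + s ^ 3) / (3 * x ^ 6)) ((x * v - s) / x))"
proof -
  let ?a = "- s / x ^ 3"
  have "s + ?a * x ^ 3 = 0"
    "t + ?a * s + ?a\<^sup>2 / 2 * x ^ 3 = (2 * x ^ 3 * t - s\<^sup>2) / (2 * x ^ 3)"
    "u + ?a * t + ?a\<^sup>2 / 2 * s + ?a ^ 3 / 6 * x ^ 3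
       = (3 * x ^ 6 * u - 3 * x ^ 3 * t * s + s ^ 3) / (3 * x ^ 6)"
    "v + ?a * x\<^sup>2 = (x * v - s) / x"
    using assms by (simp_all add: field_simps power2_eq_square eval_nat_numeral)
  then show ?thesis
    using meval_flow [of x s ?a t u v] by metis
qed

text \<open>Here \<open>?a\<close> solves \<open>t + a * s = 0\<close>, and the numerator is the
  value of \<open>f6\<close> at \<open>x = 0\<close>.\<close>

lemma meval_normal_form_s:
  assumes "s \<noteq> 0"
  shows "meval f (point5 0 s t u v)
       = meval f (point5 0 s 0 ((6 * s ^ 3 * u - 3 * t\<^sup>2 * s\<^sup>2) / (6 * s ^ 3)) v)"
proof -
  let ?a = "- t / s"
  have "s + ?a * 0 ^ 3 = s" "t + ?a * s + ?a\<^sup>2 / 2 * 0 ^ 3 = 0"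
    "u + ?a * t + ?a\<^sup>2 / 2 * s + ?a ^ 3 / 6 * 0 ^ 3
       = (6 * s ^ 3 * u - 3 * t\<^sup>2 * s\<^sup>2) / (6 * s ^ 3)"
    "v + ?a * 0\<^sup>2 = v"
    using assms by (simp_all add: field_simps power2_eq_square eval_nat_numeral)
  then show ?thesis
    using meval_flow [of 0 s ?a t u v] by metis
qed

text \<open>For \<open>e \<noteq> 0\<close> the element \<open>a = 1 / (6 * t * e ^ 3)\<close> moves the point
  \<open>(-6 * t * e\<^sup>2, 0, t, u, v)\<close> to \<open>(-6 * t * e\<^sup>2, -36 * t\<^sup>2 * e ^ 3, -2 * t, u, v + 6 * t * e)\<close>.
  Both curves are polynomial in \<open>e\<close>, although \<open>a\<close> has a pole at \<open>e = 0\<close>.\<close>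

lemma meval_doubling:
  "meval f (point5 0 0 (- 2 * t) u v) = meval f (point5 0 0 t u v)"
proof (cases "t = 0")
  case False
  let ?x = "[:0, 0, - 6 * t:]"
  let ?P = "peval f (point5 ?x 0 [:t:] [:u:] [:v:])"
  let ?Q = "peval f (point5 ?x [:0, 0, 0, - 36 * t\<^sup>2:] [:- 2 * t:] [:u:] [:v, 6 * t:])"
  \<comment> \<open>The flow compares the two curves only for \<open>e \<noteq> 0\<close>. The extra
    factor makes the identity hold for all \<open>e\<close>, and is cancelled afterwards as a
    nonzero polynomial.\<close>
  have "poly ([:0, 1:] * (?Q - ?P)) e = 0" for e
  proof (cases "e = 0")
    case nz: False
    \<comment> \<open>Starting from \<open>s = 0\<close>, the coordinate \<open>u\<close> is fixed
      if \<open>a\<^sup>2 * y ^ 3 = - 6 * t\<close>, and then \<open>t\<close> becomes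
      \<open>t - 3 * t\<close>. The parameter \<open>e\<close> is chosen to solve this
      rationally.\<close>
    let ?a = "1 / (6 * t * e ^ 3)" and ?y = "- 6 * t * e\<^sup>2"
    have "0 + ?a * ?y ^ 3 = - 36 * t\<^sup>2 * e ^ 3" "t + ?a * 0 + ?a\<^sup>2 / 2 * ?y ^ 3 = - 2 * t"
      "u + ?a * t + ?a\<^sup>2 / 2 * 0 + ?a ^ 3 / 6 * ?y ^ 3 = u" "v + ?a * ?y\<^sup>2 = v + 6 * t * e"
      using False nz by (simp_all add: field_simps eval_nat_numeral)
    then have "meval f (point5 ?y (- 36 * t\<^sup>2 * e ^ 3) (- 2 * t) u (v + 6 * t * e))
        = meval f (point5 ?y 0 t u v)"
      using meval_flow [of ?y 0 ?a t u v] by metis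
    then show ?thesis
      by (simp add: poly_peval poly_point5 power2_eq_square power3_eq_cube mult_ac)
  qed simp
  then have "[:0, 1:] * (?Q - ?P) = 0"
    by (simp only: poly_all_0_iff_0 [symmetric] simp_thms)
  then have "?Q = ?P"
    by (simp only: mult_eq_0_iff) simp
  then have "poly ?Q 0 = poly ?P 0"
    by simp
  then show ?thesis
    by (simp add: poly_peval poly_point5)
qed simp

text \<open>As a polynomial in \<open>t\<close>, the value is unchanged by the substitution of
  \<open>- 2 * t\<close>, hence has degree 0.\<close>

lemma meval_indep_t: "meval f (point5 0 0 t u v) = meval f (point5 0 0 0 u v)"
proof -
  let ?P = "peval f (point5 0 0 [:0, 1:] [:u:] [:v:])"
  have P: "poly ?P t = meval f (point5 0 0 t u v)" for t
    by (simp add: poly_peval poly_point5)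
  have "poly (pcompose ?P [:0, - 2:]) = poly ?P"
    using meval_doubling by (simp add: fun_eq_iff poly_pcompose P mult.commute)
  then have "degree ?P = 0"
    by (intro degree_0_if_pcompose_eq) (simp only: poly_eq_poly_eq_iff)
  then obtain c where "?P = [:c:]"
    by (rule degree_eq_zeroE)
  then have "poly ?P t = poly ?P 0"
    by simp
  then show ?thesis by (simp only: P)
qed

lemma meval_indep_u: "meval f (point5 0 0 0 u v) = meval f (point5 0 0 0 0 v)"
  \<comment> \<open>At \<open>t = 1\<close> the time \<open>u\<close> moves the fourth coordinate
    from 0 to \<open>u\<close> and fixes the others.\<close>
  using meval_flow [of 0 0 u 1 0 v] by (simp add: meval_indep_t [of 1])

lemma meval_indep_v: "meval f (point5 0 0 0 0 v) = meval f (point5 0 0 0 0 0)"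
proof -
  have partial_v: "meval (partial 5 f) (point5 0 0 0 0 v) = 0" for v
  proof -
    \<comment> \<open>With \<open>x\<close> an indeterminate, the factor \<open>x\<^sup>2\<close>
      can be cancelled before setting \<open>x = 0\<close>.\<close>
    let ?X = "[:0, 1 :: 'k:]"
    let ?g = "point5 ?X 0 0 0 [:v:]"
    have "?X\<^sup>2 * (?X * peval (partial 2 f) ?g + peval (partial 5 f) ?g) = peval (DF_deriv f) ?g"
      unfolding DF_deriv_def peval_add peval_mult peval_power peval_mvar point5_nth
      by (simp only: algebra_simps power2_eq_square power3_eq_cube mult_zero_left add_0_left)
    then have "?X * peval (partial 2 f) ?g + peval (partial 5 f) ?g = 0"
      unfolding DF0 peval_0 mult_eq_0_iff power_eq_0_iff by simp
    from arg_cong [OF this, of "\<lambda>p. poly p 0"] show ?thesis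
      by (simp add: poly_peval poly_point5)
  qed
  let ?P = "peval f (point5 0 0 0 0 [:0, 1:])"
  have "pderiv ?P = peval (partial 5 f) (point5 0 0 0 0 [:0, 1:])"
    by (simp add: pderiv_peval sum_UNIV_5 pderiv_pCons)
  also have "\<dots> = 0"
    unfolding poly_all_0_iff_0 [symmetric] by (simp add: poly_peval poly_point5 partial_v)
  finally have "poly ?P v = poly ?P 0"
    by (rule pderiv_eq_0_imp_poly_eq)
  then show ?thesis by (simp add: poly_peval poly_point5)
qed

lemma meval_const_x_s: "meval f (point5 0 0 t u v) = meval f (point5 0 0 0 0 0)"
  using meval_indep_t [of t u v] meval_indep_u [of u v] meval_indep_v [of v] by simp

section \<open>Separation of points by the six invariants\<close>

lemma meval_separated:
  assumes "x = x'" "2 * x ^ 3 * t - s\<^sup>2 = 2 * x' ^ 3 * t' - s'\<^sup>2"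
    and "3 * x ^ 6 * u - 3 * x ^ 3 * t * s + s ^ 3 = 3 * x' ^ 6 * u' - 3 * x' ^ 3 * t' * s' + s' ^ 3"
    and "x * v - s = x' * v' - s'"
    and "x\<^sup>2 * t * s - s\<^sup>2 * v + 2 * x ^ 3 * t * v - 3 * x ^ 5 * u
       = x'\<^sup>2 * t' * s' - s'\<^sup>2 * v' + 2 * x' ^ 3 * t' * v' - 3 * x' ^ 5 * u'"
    and "- 18 * x ^ 3 * t * s * u + 9 * x ^ 6 * u\<^sup>2 + 8 * x ^ 3 * t ^ 3 + 6 * s ^ 3 * u
         - 3 * t\<^sup>2 * s\<^sup>2
       = - 18 * x' ^ 3 * t' * s' * u' + 9 * x' ^ 6 * u'\<^sup>2 + 8 * x' ^ 3 * t' ^ 3 + 6 * s' ^ 3 * u'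
         - 3 * t'\<^sup>2 * s'\<^sup>2"
  shows "meval f (point5 x s t u v) = meval f (point5 x' s' t' u' v')"
proof (cases "x = 0")
  case False
  with assms(1) have "x' \<noteq> 0" by metis
  then have "meval f (point5 x' s' t' u' v')
      = meval f (point5 x' 0 ((2 * x ^ 3 * t - s\<^sup>2) / (2 * x' ^ 3))
          ((3 * x ^ 6 * u - 3 * x ^ 3 * t * s + s ^ 3) / (3 * x' ^ 6)) ((x * v - s) / x'))"
    unfolding assms(2-4) by (rule meval_normal_form_x)
  with meval_normal_form_x [OF False, of s t u v] show ?thesis
    by (simp only: assms(1))
next
  case True
  with assms(1) have x: "x = 0" "x' = 0" by metis+
  \<comment> \<open>At \<open>x = 0\<close> the invariant \<open>f4\<close> reduces to
    \<open>- s\<close>.\<close>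
  with assms(4) have s: "s' = s" by simp
  show ?thesis
  proof (cases "s = 0")
    case True
    then show ?thesis
      unfolding x s by (metis meval_const_x_s)
  next
    case False
    \<comment> \<open>At \<open>x = 0\<close> the invariant \<open>f5\<close> reduces to
      \<open>- s\<^sup>2 * v\<close>, and \<open>s\<close> is nonzero.\<close>
    have "v' = v"
      using assms(5) False unfolding x s by simp
    moreover have "6 * s ^ 3 * u' - 3 * t'\<^sup>2 * s\<^sup>2 = 6 * s ^ 3 * u - 3 * t\<^sup>2 * s\<^sup>2"
      using assms(6) unfolding x s by simp
    ultimately show ?thesis
      using meval_normal_form_s [OF False, of t u v] meval_normal_form_s [OF False, of t' u' v']
      unfolding x s by metis
  qed
qed

end

theorem theorem2p1:
  fixes x s t u v f1 f2 f3 f4 f5 f6 :: "(5, 'k::field_char_0) mpoly"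
  assumes "x = mvar 1" and "s = mvar 2" and "t = mvar 3" and "u = mvar 4" and "v = mvar 5"
    and "f1 = x"
    and "f2 = 2 * x ^ 3 * t - s ^ 2"
    and "f3 = 3 * x ^ 6 * u - 3 * x ^ 3 * t * s + s ^ 3"
    and "f4 = x * v - s"
    and "f5 = x ^ 2 * t * s - s ^ 2 * v + 2 * x ^ 3 * t * v - 3 * x ^ 5 * u"
    and "f6 = - 18 * x ^ 3 * t * s * u + 9 * x ^ 6 * u ^ 2 + 8 * x ^ 3 * t ^ 3
              + 6 * s ^ 3 * u - 3 * t ^ 2 * s ^ 2"
  shows "(\<forall>f\<in>{f1, f2, f3, f4, f5, f6}. homogeneous DF_grading f)
    \<and> (\<forall>f\<in>{f1, f2, f3, f4, f5, f6}. f \<in> Ga_invariants DF_deriv)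
    \<and> separating_set (Ga_invariants DF_deriv) {f1, f2, f3, f4, f5, f6}"
proof -
  let ?E = "{f1, f2, f3, f4, f5, f6}"
  note f = assms(6-11)
  have D: "DF_deriv x = 0" "DF_deriv s = x ^ 3" "DF_deriv t = s" "DF_deriv u = t"
    "DF_deriv v = x\<^sup>2"
    by (simp_all add: assms(1-5) DF_deriv_coordinates)
  note D_simps = DF_deriv_add DF_deriv_diff DF_deriv_minus DF_deriv_mult DF_deriv_power_numeral
  have inv: "\<forall>f\<in>?E. f \<in> Ga_invariants DF_deriv"
  proof -
    have "DF_deriv f1 = 0" "DF_deriv f2 = 0" "DF_deriv f3 = 0" "DF_deriv f4 = 0"
      "DF_deriv f5 = 0" "DF_deriv f6 = 0"
      unfolding f by (simp_all add: D_simps D) (simp_all add: eval_nat_numeral algebra_simps)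
    then show ?thesis by (auto intro: invariant_if_DF_deriv_eq_0)
  qed
  have hom: "\<forall>f\<in>?E. homogeneous DF_grading f"
  proof -
    let ?H = "homogeneous_of DF_grading"
    have grading: "DF_grading 1 = 1" "DF_grading 2 = 3" "DF_grading 3 = 3" "DF_grading 4 = 3"
      "DF_grading 5 = 2"
      by (simp_all add: DF_grading_def)
    have X: "?H 1 x" "?H 3 s" "?H 3 t" "?H 3 u" "?H 2 v"
      using homogeneous_of_mvar [of DF_grading 1] homogeneous_of_mvar [of DF_grading 2]
        homogeneous_of_mvar [of DF_grading 3] homogeneous_of_mvar [of DF_grading 4]
        homogeneous_of_mvar [of DF_grading 5]
      unfolding assms(1-5) grading by simp_all
    \<comment> \<open>Degrees enter \<open>pow\<close> and \<open>mult\<close> through separate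
      equations, so that the rules match a goal whose degree is a numeral.\<close>
    have pow: "?H e (g ^ n)" if "?H d g" "n * d = e" for d e n and g :: "(5, 'k) mpoly"
      using homogeneous_of_power [OF that(1), of n] that(2) by simp
    have mult: "?H k (g * h)" if "?H d g" "?H e h" "d + e = k"
      for d e k and g h :: "(5, 'k) mpoly"
      using homogeneous_of_mult [OF that(1,2)] that(3) by simp
    note H = homogeneous_of_add homogeneous_of_diff homogeneous_of_minus homogeneous_of_numeral
      pow mult X
    have "?H 1 f1" "?H 6 f2" "?H 9 f3" "?H 3 f4" "?H 8 f5" "?H 12 f6"
      unfolding f by (rule H | simp)+
    then show ?thesis by (auto intro: homogeneous_of_imp_homogeneous)
  qed
  have "meval f p = meval f q"
    if E: "\<forall>f\<in>?E. meval f p = meval f q" and "f \<in> Ga_invariants DF_deriv" for p q f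
  proof -
    have DF0: "DF_deriv f = 0" using that(2) by (rule DF_deriv_eq_0_if_invariant)
    have "meval f1 p = meval f1 q" "meval f2 p = meval f2 q" "meval f3 p = meval f3 q"
      "meval f4 p = meval f4 q" "meval f5 p = meval f5 q" "meval f6 p = meval f6 q"
      using E by simp_all
    \<comment> \<open>Evaluation turns the six equalities into exactly the coordinate hypotheses of
      \<open>meval_separated\<close>.\<close>
    note eqs = this [unfolded f assms(1-5) meval_simps meval_numeral]
    have "meval f (point5 (p $ 1) (p $ 2) (p $ 3) (p $ 4) (p $ 5))
        = meval f (point5 (q $ 1) (q $ 2) (q $ 3) (q $ 4) (q $ 5))"
      using DF0 eqs by (rule meval_separated)
    then show ?thesis by (simp only: point5_eta)
  qed
  with inv have "separating_set (Ga_invariants DF_deriv) ?E"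
    unfolding separating_set_def by blast
  with hom inv show ?thesis by blast
qed

end
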